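(* Let $u,v\ge 1$, let $a, b, L_h \in (0,1)$ satisfy $a L_h < b$, and let $L_x \ge 0$. Let $\mathbf{f}: \mathbb{R}^u \times \mathbb{R}^v \to \mathbb{R}^v$ be $L_x$-Lipschitz in its first argument and $L_h$-Lipschitz in its second argument, with $\mathbf{f}(\mathbf{0}, \mathbf{0}) = \mathbf{0}$. Then the ODE $$\frac{d\mathbf{h}(t)}{dt} = a\, \mathbf{f}(\hat{\mathbf{x}}(t), \mathbf{h}(t)) - b\, \mathbf{h}(t), \qquad \mathbf{h}(0) = \mathbf{h}_0,$$ with input signal $\hat{\mathbf{x}}$, is input-to-state stable.
   Context: Input-to-state stability: a controlled ODE $\frac{d\mathbf{h}}{dt} = \mathbf{g}(\hat{\mathbf{x}}(t), \mathbf{h}(t))$, $\mathbf{h}(0) = \mathbf{h}_0$, is called input-to-state stable if there exist continuous functions $\gamma: \mathbb{R}_+ \to \mathbb{R}_+$, increasing with $\gamma(0) = 0$, and $\beta: \mathbb{R}_+^2 \to \mathbb{R}_+$, such that $\beta(\cdot, t)$ is increasing with $\beta(0,t) = 0$ for every $t$, and for every $r > 0$ the function $\beta(r, \cdot)$ is strictly decreasing with $\beta(r,t) \to 0$ as $t \to \infty$, such that $$\|\mathbf{h}(t)\|_2 \le \beta(\|\mathbf{h}_0\|_2, t) + \gamma(\|\hat{\mathbf{x}}\|_\infty)$$ for every initial state $\mathbf{h}_0 \in \mathbb{R}^v$, every bounded continuous input $\hat{\mathbf{x}}: [0,\infty) \to \mathbb{R}^u$ and every $t \ge 0$, where $\|\hat{\mathbf{x}}\|_\infty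 = \sup_{t \ge 0} \|\hat{\mathbf{x}}(t)\|_2$. *)

theory Defs
  imports "HOL-Analysis.Analysis"
begin

text \<open>The time axis is the half line \<open>{0..}\<close>; at time 0 the derivative is one-sided.\<close>

definition controlled_ode_solution ::
    "(real^'u \<Rightarrow> real^'v \<Rightarrow> real^'v) \<Rightarrow> (real \<Rightarrow> real^'u) \<Rightarrow> real^'v \<Rightarrow> (real \<Rightarrow> real^'v) \<Rightarrow> bool" where
  "controlled_ode_solution g x h0 h \<longleftrightarrow>
     h 0 = h0 \<and> (\<forall>t\<ge>0. (h has_vector_derivative g (x t) (h t)) (at t within {0..}))"

definition admissible_input :: "(real \<Rightarrow> real^'u) \<Rightarrow> bool" where
  "admissible_input x \<longleftrightarrow> continuous_on {0..} x \<and> bounded (x ` {0..})"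

definition input_sup_norm :: "(real \<Rightarrow> real^'u) \<Rightarrow> real" where
  "input_sup_norm x = (SUP t\<in>{0..}. norm (x t))"

text \<open>Comparison functions are only constrained on nonnegative arguments. ``Increasing'' is read
  strictly, as is usual for comparison functions; the weak reading gives an equivalent notion of
  input-to-state stability, since one may add \<open>s\<close> to \<open>\<gamma> s\<close> and \<open>r * exp (- t)\<close> to \<open>\<beta> r t\<close>.\<close>

definition gain_function :: "(real \<Rightarrow> real) \<Rightarrow> bool" where
  "gain_function \<gamma> \<longleftrightarrow>
     continuous_on {0..} \<gamma> \<and> (\<forall>s\<ge>0. \<gamma> s \<ge> 0) \<and> strict_mono_on {0..} \<gamma> \<and> \<gamma> 0 = 0"

definition decay_function :: "(real \<Rightarrow> real \<Rightarrow> real) \<Rightarrow> bool" where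
  "decay_function \<beta> \<longleftrightarrow>
     continuous_on ({0..} \<times> {0..}) (\<lambda>(r, t). \<beta> r t) \<and>
     (\<forall>r\<ge>0. \<forall>t\<ge>0. \<beta> r t \<ge> 0) \<and>
     (\<forall>t\<ge>0. strict_mono_on {0..} (\<lambda>r. \<beta> r t) \<and> \<beta> 0 t = 0) \<and>
     (\<forall>r>0. (\<forall>s\<ge>0. \<forall>t>s. \<beta> r t < \<beta> r s) \<and> (\<beta> r \<longlongrightarrow> 0) at_top)"

text \<open>The estimate is about the state \<open>h t\<close> at every \<open>t \<ge> 0\<close>, so it presupposes that
  the equation is solvable on the whole half line. Global existence is therefore required
  explicitly; otherwise the estimate could hold vacuously. It is then imposed on every solution.\<close>

definition input_to_state_stable :: "(real^'u \<Rightarrow> real^'v \<Rightarrow> real^'v) \<Rightarrow> bool" where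
  "input_to_state_stable g \<longleftrightarrow>
     (\<exists>\<gamma> \<beta>. gain_function \<gamma> \<and> decay_function \<beta> \<and>
       (\<forall>h0 x. admissible_input x \<longrightarrow>
          (\<exists>h. controlled_ode_solution g x h0 h) \<and>
          (\<forall>h. controlled_ode_solution g x h0 h \<longrightarrow>
             (\<forall>t\<ge>0. norm (h t) \<le> \<beta> (norm h0) t + \<gamma> (input_sup_norm x)))))"

end

theory Submission
  imports Defs
begin

text \<open>Solutions satisfy the variation of constants equation
  \<open>h t = exp (- b t) (h0 + a \<integral>\<^sub>0\<^sup>t exp (b s) f (x s) (h s) ds)\<close>. On the bounded continuous functions
  with the supremum norm, its right-hand side is a contraction with constant \<open>a L_h / b < 1\<close>, so
  a single application of Banach's theorem yields a solution on the whole half line.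
  For the estimate put \<open>\<mu> = b - a L_h\<close> and \<open>c = a L_x \<parallel>x\<parallel>\<close>, the norm being the supremum norm. The
  one-sided bound \<open>h \<bullet> h' \<le> c |h| - \<mu> |h|\<^sup>2\<close> says formally that \<open>|h|' \<le> c - \<mu> |h|\<close>, whence
  \<open>|h t| \<le> exp (- \<mu> t) |h 0| + c / \<mu>\<close>.\<close>

section \<open>Superposition and weighted integrals\<close>

text \<open>The state is moved first, at fixed time \<open>s\<close>, at a cost of
  \<open>L * dist (\<phi> s) (\<phi> t)\<close>; then time moves with the state frozen at
  \<open>\<phi> t\<close>. As \<open>L\<close> is common to all times, both contributions vanish in
  the limit.\<close>

lemma continuous_on_lipschitz_superposition:
  fixes F :: "'t::topological_space \<Rightarrow> 'a::metric_space \<Rightarrow> 'b::metric_space"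
  assumes "continuous_on S \<phi>"
    and "\<And>y. continuous_on S (\<lambda>t. F t y)"
    and "\<And>t. t \<in> S \<Longrightarrow> L-lipschitz_on UNIV (F t)"
  shows "continuous_on S (\<lambda>t. F t (\<phi> t))"
  unfolding continuous_on_def
proof
  fix t assume t: "t \<in> S"
  have "((\<lambda>s. dist (F s (\<phi> s)) (F t (\<phi> t))) \<longlongrightarrow> 0) (at t within S)"
  proof (rule tendsto_sandwich[OF always_eventually])
    show "\<forall>s. 0 \<le> dist (F s (\<phi> s)) (F t (\<phi> t))"
      by simp
    show "\<forall>\<^sub>F s in at t within S. dist (F s (\<phi> s)) (F t (\<phi> t))
        \<le> L * dist (\<phi> s) (\<phi> t) + dist (F s (\<phi> t)) (F t (\<phi> t))"
      unfolding eventually_at_filter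
    proof (intro always_eventually allI impI)
      fix s assume "s \<in> S"
      then have "dist (F s (\<phi> s)) (F s (\<phi> t)) \<le> L * dist (\<phi> s) (\<phi> t)"
        using lipschitz_onD[OF assms(3)] by simp
      then show "dist (F s (\<phi> s)) (F t (\<phi> t))
          \<le> L * dist (\<phi> s) (\<phi> t) + dist (F s (\<phi> t)) (F t (\<phi> t))"
        using dist_triangle[of "F s (\<phi> s)" "F t (\<phi> t)" "F s (\<phi> t)"] by linarith
    qed
    have "((\<lambda>s. L * dist (\<phi> s) (\<phi> t) + dist (F s (\<phi> t)) (F t (\<phi> t)))
        \<longlongrightarrow> L * dist (\<phi> t) (\<phi> t) + dist (F t (\<phi> t)) (F t (\<phi> t))) (at t within S)"
      using assms(1) assms(2)[of "\<phi> t"] t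
      by (intro tendsto_intros) (auto simp: continuous_on_def)
    then show "((\<lambda>s. L * dist (\<phi> s) (\<phi> t) + dist (F s (\<phi> t)) (F t (\<phi> t))) \<longlongrightarrow> 0) (at t within S)"
      by simp
  qed simp
  then show "((\<lambda>s. F s (\<phi> s)) \<longlongrightarrow> F t (\<phi> t)) (at t within S)"
    by (rule tendsto_dist_iff[THEN iffD2])
qed

lemma has_vector_derivative_integral_atLeast:
  fixes f :: "real \<Rightarrow> 'a::banach"
  assumes "continuous_on {a..} f" "a \<le> t"
  shows "((\<lambda>u. integral {a..u} f) has_vector_derivative f t) (at t within {a..})"
proof -
  have "((\<lambda>u. integral {a..u} f) has_vector_derivative f t) (at t within {a..t + 1})"
    using assms by (intro integral_has_vector_derivative continuous_on_subset[OF assms(1)]) auto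
  \<comment> \<open>The filter depends only on the set near \<open>t\<close>, and the endpoint
    \<open>t + 1\<close> keeps the artificial right boundary away from \<open>t\<close>.\<close>
  moreover have "at t within {a..t + 1} = at t within {a..}"
    by (rule at_within_nhd[of t "{..<t + 1}"]) auto
  ultimately show ?thesis
    by simp
qed

text \<open>The kernel \<open>exp (- b * (t - s))\<close> has mass at most \<open>1 / b\<close> on
  \<open>{0..t}\<close>, uniformly in \<open>t\<close>. Both the boundedness of the fixed point map
  and its contraction constant \<open>L / b\<close> come from this.\<close>

lemma norm_exp_weighted_integral_le:
  fixes G :: "real \<Rightarrow> 'a::banach"
  assumes "0 < b" "0 \<le> t" "0 \<le> K"
    and G: "continuous_on {0..t} G" "\<And>s. \<lbrakk>0 \<le> s; s \<le> t\<rbrakk> \<Longrightarrow> norm (G s) \<le> K"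
  shows "norm (exp (- (b * t)) *\<^sub>R integral {0..t} (\<lambda>s. exp (b * s) *\<^sub>R G s)) \<le> K / b"
proof -
  have I: "((\<lambda>s. exp (b * s) * K) has_integral (exp (b * t) * K / b - exp (b * 0) * K / b)) {0..t}"
    using assms(1,2)
    by (intro fundamental_theorem_of_calculus)
       (auto intro!: derivative_eq_intros simp flip: has_real_derivative_iff_has_vector_derivative)
  have "norm (integral {0..t} (\<lambda>s. exp (b * s) *\<^sub>R G s)) \<le> integral {0..t} (\<lambda>s. exp (b * s) * K)"
  proof (rule integral_norm_bound_integral)
    show "(\<lambda>s. exp (b * s) *\<^sub>R G s) integrable_on {0..t}"
      by (intro integrable_continuous_real continuous_intros G)
  qed (use G(2) I in \<open>auto intro!: mult_left_mono\<close>)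
  also have "\<dots> = (exp (b * t) - 1) * (K / b)"
    using integral_unique[OF I] by (simp add: algebra_simps)
  also have "\<dots> \<le> exp (b * t) * (K / b)"
    using assms(1,3) by (intro mult_right_mono) auto
  finally have "norm (integral {0..t} (\<lambda>s. exp (b * s) *\<^sub>R G s)) \<le> exp (b * t) * (K / b)" .
  then have "exp (- (b * t)) * norm (integral {0..t} (\<lambda>s. exp (b * s) *\<^sub>R G s))
      \<le> exp (- (b * t)) * (exp (b * t) * (K / b))"
    by (intro mult_left_mono) auto
  also have "\<dots> = K / b"
    by (simp add: exp_minus)
  finally show ?thesis
    by simp
qed

section \<open>Global existence\<close>

text \<open>The bound \<open>C\<close>, uniform in time, makes the fixed point map send bounded
  functions to bounded functions; \<open>L < b\<close> makes it a contraction.\<close>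

lemma dissipative_ode_global_solution:
  fixes F :: "real \<Rightarrow> 'a::banach \<Rightarrow> 'a"
  assumes "0 < b" "L < b"
    and cont: "\<And>y. continuous_on {0..} (\<lambda>t. F t y)"
    and lip: "\<And>t. 0 \<le> t \<Longrightarrow> L-lipschitz_on UNIV (F t)"
    and bdd: "\<And>t. 0 \<le> t \<Longrightarrow> norm (F t 0) \<le> C"
  shows "\<exists>h. h 0 = h0 \<and>
    (\<forall>t\<ge>0. (h has_vector_derivative F t (h t) - b *\<^sub>R h t) (at t within {0..}))"
proof -
  have L: "0 \<le> L"
    using lip[of 0] lipschitz_on_nonneg by auto
  have C: "0 \<le> C"
    using bdd[of 0] norm_ge_zero[of "F 0 0"] by linarith
  define E where "E \<phi> t = integral {0..t} (\<lambda>s. exp (b * s) *\<^sub>R F s (apply_bcontfun \<phi> s))"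
    for \<phi> :: "real \<Rightarrow>\<^sub>C 'a" and t
  define S where "S \<phi> t = exp (- (b * t)) *\<^sub>R (h0 + E \<phi> t)" for \<phi> t
  have contF: "continuous_on {0..} (\<lambda>s. F s (apply_bcontfun \<phi> s))" for \<phi>
    by (rule continuous_on_lipschitz_superposition[OF _ cont, of _ L]) (auto intro: lip)
  \<comment> \<open>With \<open>\<phi>\<close> frozen inside \<open>F\<close>,
    \<open>S \<phi>\<close> solves a linear equation; it becomes the desired one once
    \<open>S \<phi> = \<phi>\<close> on the half line.\<close>
  have S_deriv: "(S \<phi> has_vector_derivative F t (apply_bcontfun \<phi> t) - b *\<^sub>R S \<phi> t) (at t within {0..})"
    if "0 \<le> t" for \<phi> t
  proof -
    have "(E \<phi> has_vector_derivative exp (b * t) *\<^sub>R F t (apply_bcontfun \<phi> t)) (at t within {0..})"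
      unfolding E_def using that
      by (intro has_vector_derivative_integral_atLeast continuous_intros contF) auto
    then show ?thesis
      unfolding S_def
      by (auto intro!: derivative_eq_intros
            simp: scaleR_add_right exp_minus algebra_simps
            simp flip: has_real_derivative_iff_has_vector_derivative)
  qed
  have S_cont: "continuous_on {0..} (S \<phi>)" for \<phi>
    unfolding continuous_on_eq_continuous_within
    by (auto intro: has_vector_derivative_continuous[OF S_deriv])
  have S_bound: "norm (S \<phi> t) \<le> norm h0 + (C + L * norm \<phi>) / b" if "0 \<le> t" for \<phi> t
  proof -
    have "norm (F s (apply_bcontfun \<phi> s)) \<le> C + L * norm \<phi>" if "0 \<le> s" for s
    proof -
      have "norm (F s (apply_bcontfun \<phi> s) - F s 0) \<le> L * norm (apply_bcontfun \<phi> s)"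
        using lipschitz_on_normD[OF lip[OF that], of "apply_bcontfun \<phi> s" 0] by simp
      also have "\<dots> \<le> L * norm \<phi>"
        using L norm_bounded by (intro mult_left_mono) auto
      finally show ?thesis
        using bdd[OF that] norm_triangle_sub[of "F s (apply_bcontfun \<phi> s)" "F s 0"] by linarith
    qed
    then have "norm (exp (- (b * t)) *\<^sub>R E \<phi> t) \<le> (C + L * norm \<phi>) / b"
      unfolding E_def using assms(1) L C that
      by (intro norm_exp_weighted_integral_le continuous_on_subset[OF contF]) auto
    moreover have "norm (exp (- (b * t)) *\<^sub>R h0) \<le> norm h0"
      using assms(1) that by (simp add: mult_left_le_one_le)
    ultimately show ?thesis
      unfolding S_def scaleR_add_right by (intro norm_triangle_le) linarith
  qed
  have S_contraction: "dist (S \<phi> t) (S \<psi> t) \<le> L / b * dist \<phi> \<psi>" if "0 \<le> t" for \<phi> \<psi> t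
  proof -
    have int: "(\<lambda>s. exp (b * s) *\<^sub>R F s (apply_bcontfun \<phi> s)) integrable_on {0..t}" for \<phi>
      by (intro integrable_continuous_real continuous_intros continuous_on_subset[OF contF]) auto
    \<comment> \<open>The initial value cancels, which leaves a weighted integral of differences of
      \<open>F\<close>.\<close>
    have "S \<phi> t - S \<psi> t = exp (- (b * t)) *\<^sub>R integral {0..t}
        (\<lambda>s. exp (b * s) *\<^sub>R (F s (apply_bcontfun \<phi> s) - F s (apply_bcontfun \<psi> s)))"
      unfolding S_def E_def
      by (simp add: scaleR_diff_right[symmetric] integral_diff[symmetric] int)
    also have "norm \<dots> \<le> (L * dist \<phi> \<psi>) / b"
    proof (intro norm_exp_weighted_integral_le)
      fix s assume s: "0 \<le> s" "s \<le> t"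
      have "norm (F s (apply_bcontfun \<phi> s) - F s (apply_bcontfun \<psi> s))
          \<le> L * dist (apply_bcontfun \<phi> s) (apply_bcontfun \<psi> s)"
        using lipschitz_onD[OF lip[OF s(1)]] by (simp add: dist_norm)
      also have "\<dots> \<le> L * dist \<phi> \<psi>"
        using L dist_bounded by (intro mult_left_mono) auto
      finally show "norm (F s (apply_bcontfun \<phi> s) - F s (apply_bcontfun \<psi> s)) \<le> L * dist \<phi> \<psi>" .
    qed (use assms(1) L that in \<open>auto intro!: continuous_intros continuous_on_subset[OF contF]\<close>)
    finally show ?thesis
      by (simp add: dist_norm)
  qed
  \<comment> \<open>Functions on the half line are extended to the negative axis as constants, so that the
    complete type of bounded continuous functions on \<open>real\<close> can be used.\<close>
  define T where "T \<phi> = Bcontfun (\<lambda>t. S \<phi> (max 0 t))" for \<phi>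
  have T: "apply_bcontfun (T \<phi>) t = S \<phi> (max 0 t)" for \<phi> t
  proof -
    have "(\<lambda>t. S \<phi> (max 0 t)) \<in> bcontfun"
      by (rule bcontfun_normI[OF continuous_on_compose2[OF S_cont] S_bound])
         (auto intro!: continuous_intros)
    then show ?thesis
      by (simp add: T_def Bcontfun_inverse)
  qed
  have "\<exists>!\<phi>. T \<phi> = \<phi>"
  proof (rule banach_fix_type[of "L / b"])
    show "\<forall>\<phi> \<psi>. dist (T \<phi>) (T \<psi>) \<le> L / b * dist \<phi> \<psi>"
      by (intro allI dist_bound, unfold T) (rule S_contraction, simp)
  qed (use assms(1,2) L in auto)
  then obtain \<phi> where "T \<phi> = \<phi>"
    by blast
  \<comment> \<open>For \<open>0 \<le> t\<close> the constant extension is invisible, as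
    \<open>max 0 t = t\<close>.\<close>
  then have \<phi>: "apply_bcontfun \<phi> t = S \<phi> t" if "0 \<le> t" for t
    using T[of \<phi> t] that by simp
  have "S \<phi> 0 = h0"
    by (simp add: S_def E_def)
  moreover have "(S \<phi> has_vector_derivative F t (S \<phi> t) - b *\<^sub>R S \<phi> t) (at t within {0..})"
    if "0 \<le> t" for t
    using S_deriv[OF that, of \<phi>] \<phi>[OF that] by simp
  ultimately show ?thesis
    by blast
qed

section \<open>Exponential decay estimate\<close>

text \<open>Only the dissipation inequality enters, so the bound applies to every solution. It is
  proved up to an arbitrary \<open>e\<close>, which pays for the regularisation of the norm.\<close>

lemma norm_le_exp_decay:
  fixes h :: "real \<Rightarrow> 'a::real_inner"
  assumes deriv: "\<And>t. 0 \<le> t \<Longrightarrow> (h has_vector_derivative h' t) (at t within {0..})"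
    and diss: "\<And>t. 0 \<le> t \<Longrightarrow> h t \<bullet> h' t \<le> c * norm (h t) - \<mu> * (norm (h t))\<^sup>2"
    and "0 < \<mu>" "0 \<le> c" "0 \<le> t"
  shows "norm (h t) \<le> norm (h 0) * exp (- (\<mu> * t)) + c / \<mu>"
proof (rule field_le_epsilon)
  fix e :: real assume "0 < e"
  define \<epsilon> where "\<epsilon> = e / 2"
  have \<epsilon>: "0 < \<epsilon>"
    using \<open>0 < e\<close> by (simp add: \<epsilon>_def)
  \<comment> \<open>The norm is regularised, since it is not differentiable at \<open>0\<close>.\<close>
  define w where "w s = sqrt (h s \<bullet> h s + \<epsilon>\<^sup>2)" for s
  \<comment> \<open>\<open>K\<close> is the rest point of the comparison equation
    \<open>w' = \<mu> * (K - w)\<close>. Its summand \<open>\<epsilon>\<close> absorbs the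
    regularisation term, since \<open>\<epsilon>\<^sup>2 \<le> \<epsilon> * w s\<close>.\<close>
  define K where "K = \<epsilon> + c / \<mu>"
  have w2: "(w s)\<^sup>2 = (norm (h s))\<^sup>2 + \<epsilon>\<^sup>2" for s
    by (simp add: w_def dot_square_norm)
  have w_ge: "norm (h s) \<le> w s" "\<epsilon> \<le> w s" for s
    using \<epsilon> by (auto simp: w_def dot_square_norm intro!: real_le_rsqrt)
  have w_pos: "0 < w s" for s
    using w_ge(2)[of s] \<epsilon> by linarith
  have w_deriv: "(w has_real_derivative (h s \<bullet> h' s) / w s) (at s within {0..})" if "0 \<le> s" for s
  proof -
    have "((\<lambda>s. h s \<bullet> h s) has_real_derivative 2 * (h s \<bullet> h' s)) (at s within {0..})"
      unfolding has_real_derivative_iff_has_vector_derivative has_vector_derivative_def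
      by (rule has_derivative_eq_rhs[OF has_derivative_inner])
         (use deriv[OF that] in \<open>auto simp: has_vector_derivative_def inner_commute algebra_simps\<close>)
    then show ?thesis
      unfolding w_def using w_pos[of s]
      by (auto intro!: derivative_eq_intros simp: w_def divide_simps)
  qed
  have w_decay: "(h s \<bullet> h' s) / w s \<le> \<mu> * (K - w s)" if "0 \<le> s" for s
  proof -
    have "h s \<bullet> h' s \<le> c * norm (h s) - \<mu> * ((w s)\<^sup>2 - \<epsilon>\<^sup>2)"
      using diss[OF that] by (simp add: w2)
    also have "\<dots> \<le> c * w s - \<mu> * ((w s)\<^sup>2 - \<epsilon> * w s)"
      using assms(3,4) w_ge[of s] \<epsilon>
      by (intro diff_mono mult_left_mono) (auto simp: power2_eq_square)
    also have "\<dots> = \<mu> * (K - w s) * w s"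
      using assms(3) by (simp add: K_def power2_eq_square field_simps)
    finally show ?thesis
      using w_pos[of s] by (simp add: pos_divide_le_eq)
  qed
  \<comment> \<open>The integrating factor turns the differential inequality for \<open>w\<close>
    into monotonicity of \<open>q\<close>.\<close>
  define q where "q s = exp (\<mu> * s) * (w s - K)" for s
  have q_deriv: "(q has_real_derivative exp (\<mu> * s) * ((h s \<bullet> h' s) / w s - \<mu> * (K - w s)))
      (at s within {0..})" if "0 \<le> s" for s
    unfolding q_def using w_deriv[OF that]
    by (auto intro!: derivative_eq_intros simp: algebra_simps)
  have "q t \<le> q 0"
  proof (rule DERIV_nonpos_imp_decreasing_open[OF assms(5)])
    fix s assume s: "0 < s" "s < t"
    \<comment> \<open>The derivative is two-sided at interior times; at time 0 continuity of
      \<open>q\<close> suffices.\<close>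
    have "at s within {0..} = at s"
      using s by (intro at_within_interior) (auto simp: interior_real_atLeast)
    then have "(q has_real_derivative exp (\<mu> * s) * ((h s \<bullet> h' s) / w s - \<mu> * (K - w s))) (at s)"
      using q_deriv[of s] s by simp
    moreover have "exp (\<mu> * s) * ((h s \<bullet> h' s) / w s - \<mu> * (K - w s)) \<le> 0"
      using w_decay[of s] s by (intro mult_nonneg_nonpos) auto
    ultimately show "\<exists>y. DERIV q s :> y \<and> y \<le> 0"
      by blast
  next
    show "continuous_on {0..t} q"
      by (rule continuous_on_subset[of "{0..}"])
         (auto intro: DERIV_continuous_on q_deriv)
  qed
  then have "exp (- (\<mu> * t)) * (exp (\<mu> * t) * (w t - K)) \<le> exp (- (\<mu> * t)) * (w 0 - K)"
    unfolding q_def by (intro mult_left_mono) auto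
  then have "w t \<le> exp (- (\<mu> * t)) * (w 0 - K) + K"
    by (simp flip: mult.assoc exp_add)
  also have "\<dots> \<le> exp (- (\<mu> * t)) * norm (h 0) + K"
  proof -
    \<comment> \<open>The excess \<open>\<epsilon>\<close> of \<open>w 0\<close> is cancelled by the
      one in \<open>K\<close>, so \<open>w 0 - K \<le> norm (h 0)\<close>.\<close>
    have "w 0 \<le> norm (h 0) + \<epsilon>"
      unfolding w_def dot_square_norm using \<epsilon> by (intro real_le_lsqrt) (auto simp: power2_sum)
    moreover have "\<epsilon> \<le> K"
      using assms(3,4) by (simp add: K_def)
    ultimately show ?thesis
      by (intro add_right_mono mult_left_mono) auto
  qed
  finally show "norm (h t) \<le> norm (h 0) * exp (- (\<mu> * t)) + c / \<mu> + e"
    using w_ge(1)[of t] \<open>0 < e\<close> by (simp add: K_def \<epsilon>_def mult.commute)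
qed

section \<open>Comparison functions and the input norm\<close>

lemma gain_function_linear: "0 < k \<Longrightarrow> gain_function (\<lambda>s. k * s)"
  by (auto simp: gain_function_def strict_mono_on_def intro!: continuous_intros)

lemma decay_function_exp:
  assumes "0 < \<mu>"
  shows "decay_function (\<lambda>r t. r * exp (- (\<mu> * t)))"
proof -
  have "((\<lambda>t. r * exp (- (\<mu> * t))) \<longlongrightarrow> r * 0) at_top" for r :: real
    using assms
    by (intro tendsto_intros filterlim_compose[OF exp_at_bot])
       (auto simp: filterlim_uminus_at_bot intro!: filterlim_tendsto_pos_mult_at_top filterlim_ident)
  then show ?thesis
    using assms
    by (auto simp: decay_function_def strict_mono_on_def case_prod_unfold intro!: continuous_intros)
qed

text \<open>A real \<open>SUP\<close> bounds the values only when they are bounded above, which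
  admissibility guarantees.\<close>

lemma norm_le_input_sup_norm:
  assumes "admissible_input x" "0 \<le> t"
  shows "norm (x t) \<le> input_sup_norm x"
  unfolding input_sup_norm_def
proof (rule cSUP_upper)
  show "bdd_above ((\<lambda>t. norm (x t)) ` {0..})"
    using assms(1) by (auto simp: admissible_input_def bounded_iff bdd_above_def)
qed (use assms(2) in auto)

section \<open>Input-to-state stability\<close>

theorem theorem4p4:
  fixes f :: "real^'u \<Rightarrow> real^'v \<Rightarrow> real^'v"
    and a b L_h L_x :: real
  assumes "0 < a" "a < 1" "0 < b" "b < 1" "0 < L_h" "L_h < 1"
    and "a * L_h < b"
    and "L_x \<ge> 0"
    and "\<And>h. L_x-lipschitz_on UNIV (\<lambda>x. f x h)"
    and "\<And>x. L_h-lipschitz_on UNIV (\<lambda>h. f x h)"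
    and "f 0 0 = 0"
  shows "input_to_state_stable (\<lambda>x h. a *\<^sub>R f x h - b *\<^sub>R h)"
proof -
  \<comment> \<open>The net decay rate: the damping minus the largest growth that the state
    dependence of \<open>f\<close> can cause.\<close>
  define \<mu> where "\<mu> = b - a * L_h"
  have \<mu>: "0 < \<mu>"
    using assms(7) by (simp add: \<mu>_def)
  \<comment> \<open>The summand 1 keeps the gain strictly increasing when \<open>L_x = 0\<close>.\<close>
  define k where "k = a * L_x / \<mu> + 1"
  have k: "0 < k"
    using assms(1,8) \<mu> by (simp add: k_def add_nonneg_pos)
  \<comment> \<open>\<open>f y z\<close> is compared with \<open>f 0 0 = 0\<close> through
    \<open>f y 0\<close>, so that each Lipschitz condition is used in one argument.\<close>
  have f_input: "norm (f y 0) \<le> L_x * norm y" for y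
    using lipschitz_on_normD[OF assms(9), of y 0 0] assms(11) by simp
  have f_state: "norm (f y z - f y 0) \<le> L_h * norm z" for y z
    using lipschitz_on_normD[OF assms(10), of z 0 y] by simp
  \<comment> \<open>The witnesses \<open>r * exp (- (\<mu> * t))\<close> and \<open>k * s\<close>
    are fixed before \<open>h0\<close> and \<open>x\<close>, as the order of quantifiers
    demands.\<close>
  have "(\<exists>h. controlled_ode_solution (\<lambda>x h. a *\<^sub>R f x h - b *\<^sub>R h) x h0 h) \<and>
      (\<forall>h. controlled_ode_solution (\<lambda>x h. a *\<^sub>R f x h - b *\<^sub>R h) x h0 h \<longrightarrow>
        (\<forall>t\<ge>0. norm (h t) \<le> norm h0 * exp (- (\<mu> * t)) + k * input_sup_norm x))"
    if x: "admissible_input x" for x :: "real \<Rightarrow> real^'u" and h0 :: "real^'v"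
  proof (intro conjI allI impI)
    define X where "X = input_sup_norm x"
    have xX: "norm (x t) \<le> X" if "0 \<le> t" for t
      using norm_le_input_sup_norm[OF x that] by (simp add: X_def)
    have X: "0 \<le> X"
      using xX[of 0] norm_ge_zero[of "x 0"] by linarith
    have fX: "norm (f (x t) 0) \<le> L_x * X" if "0 \<le> t" for t
      using f_input[of "x t"] mult_left_mono[OF xX[OF that] assms(8)] by linarith
    show "\<exists>h. controlled_ode_solution (\<lambda>x h. a *\<^sub>R f x h - b *\<^sub>R h) x h0 h"
      unfolding controlled_ode_solution_def
    \<comment> \<open>For a fixed input the equation is non-autonomous, with Lipschitz constant
      \<open>a * L_h < b\<close> and bound \<open>C = a * (L_x * X)\<close>.\<close>
    proof (rule dissipative_ode_global_solution[OF assms(3,7), of "\<lambda>t h. a *\<^sub>R f (x t) h"])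
      show "continuous_on {0..} (\<lambda>t. a *\<^sub>R f (x t) y)" for y
        using x
        by (intro continuous_on_scaleR continuous_on_const
              continuous_on_compose2[OF lipschitz_on_continuous_on[OF assms(9)]])
           (auto simp: admissible_input_def)
      show "(a * L_h)-lipschitz_on UNIV (\<lambda>h. a *\<^sub>R f (x t) h)" for t
        using assms(1) by (intro lipschitz_on_cmult_nonneg assms(10)) auto
      show "norm (a *\<^sub>R f (x t) 0) \<le> a * (L_x * X)" if "0 \<le> t" for t
        using fX[OF that] assms(1) by simp
    qed
    fix h and t :: real
    assume h: "controlled_ode_solution (\<lambda>x h. a *\<^sub>R f x h - b *\<^sub>R h) x h0 h" and t: "0 \<le> t"
    have "norm (h t) \<le> norm (h 0) * exp (- (\<mu> * t)) + a * (L_x * X) / \<mu>"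
    proof (rule norm_le_exp_decay[OF _ _ \<mu> _ t])
      fix s :: real assume s: "0 \<le> s"
      show "(h has_vector_derivative a *\<^sub>R f (x s) (h s) - b *\<^sub>R h s) (at s within {0..})"
        using h s by (simp add: controlled_ode_solution_def)
      have "norm (f (x s) (h s)) \<le> L_x * X + L_h * norm (h s)"
        using norm_triangle_sub[of "f (x s) (h s)" "f (x s) 0"] f_state[of "x s" "h s"] fX[OF s]
        by linarith
      then have "h s \<bullet> f (x s) (h s) \<le> norm (h s) * (L_x * X + L_h * norm (h s))"
        by (intro order_trans[OF norm_cauchy_schwarz] mult_left_mono) auto
      then have "a * (h s \<bullet> f (x s) (h s)) \<le> a * (norm (h s) * (L_x * X + L_h * norm (h s)))"
        using assms(1) by (intro mult_left_mono) auto
      \<comment> \<open>The quadratic terms \<open>a * L_h\<close> and \<open>- b\<close> combine to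
        \<open>- \<mu>\<close>; the input contributes the linear term, with
        \<open>c = a * (L_x * X)\<close>.\<close>
      then show "h s \<bullet> (a *\<^sub>R f (x s) (h s) - b *\<^sub>R h s)
          \<le> a * (L_x * X) * norm (h s) - \<mu> * (norm (h s))\<^sup>2"
        by (simp add: inner_diff_right dot_square_norm \<mu>_def power2_eq_square algebra_simps)
    qed (use assms(1,8) X in auto)
    \<comment> \<open>The two sides differ by exactly \<open>X\<close>, which is
      nonnegative.\<close>
    also have "a * (L_x * X) / \<mu> \<le> k * X"
      using X by (simp add: k_def algebra_simps)
    finally show "norm (h t) \<le> norm h0 * exp (- (\<mu> * t)) + k * input_sup_norm x"
      using h by (simp add: controlled_ode_solution_def X_def)
  qed
  then show ?thesis
    unfolding input_to_state_stable_def
    using gain_function_linear[OF k] decay_function_exp[OF \<mu>] by blast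
qed

end
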